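(* Let $a$ and $b$ be coprime positive integers with $a > b \geq 3$ and $a^2+a+b > b^2+ba$. Then \[ R_3\bigl(ax+by=bz\bigr) \geq a^3 + a^2 + (2b+1)a + 1 . \]
   Context: For a linear equation $\mathcal{E}$ in the unknowns $x,y,z$ and a positive integer $k$, the $k$-colour Rado number $R_k(\mathcal{E})$ is the smallest positive integer $n$, if it exists, such that every colouring of $\{1,2,\dots,n\}$ with $k$ colours contains a monochromatic solution to $\mathcal{E}$, i.e. a solution $(x,y,z)$ with $x,y,z\in\{1,\dots,n\}$ (not necessarily distinct) all of the same colour; $R_k(\mathcal{E})=\infty$ if no such $n$ exists. In the paper's notation the equation $ax+by=bz$ is written $\mathcal{E}(3,0;a,b,b)$. *)

theory Defs
  imports Main "HOL-Library.Extended_Nat" "HOL-Library.FuncSet"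
begin

(* An equation in three unknowns is given by its solution predicate. The three components of a
   solution need not be distinct. *)
definition has_mono_solution ::
    "(nat \<Rightarrow> nat \<Rightarrow> nat \<Rightarrow> bool) \<Rightarrow> (nat \<Rightarrow> nat) \<Rightarrow> nat \<Rightarrow> bool" where
  "has_mono_solution E \<chi> n \<longleftrightarrow>
     (\<exists>x\<in>{1..n}. \<exists>y\<in>{1..n}. \<exists>z\<in>{1..n}. E x y z \<and> \<chi> x = \<chi> y \<and> \<chi> y = \<chi> z)"

definition rado_property :: "nat \<Rightarrow> (nat \<Rightarrow> nat \<Rightarrow> nat \<Rightarrow> bool) \<Rightarrow> nat \<Rightarrow> bool" where
  "rado_property k E n \<longleftrightarrow> (\<forall>\<chi> \<in> {1..n} \<rightarrow> {..<k}. has_mono_solution E \<chi> n)"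

definition rado_number :: "nat \<Rightarrow> (nat \<Rightarrow> nat \<Rightarrow> nat \<Rightarrow> bool) \<Rightarrow> enat" where
  "rado_number k E =
     (if \<exists>n>0. rado_property k E n then enat (LEAST n. n > 0 \<and> rado_property k E n) else \<infinity>)"

end

theory Submission
  imports Defs
begin

text \<open>
  Since \<open>a\<close> and \<open>b\<close> are coprime, the solutions of \<open>a x + b y = b z\<close> are the triples
  \<open>(b m, y, y + a m)\<close>. Let \<open>M = a\<^sup>3 + a\<^sup>2 + a b + a\<close>, so that \<open>M + a b\<close> is the largest number
  to be coloured. Colour 0 consists of multiples of \<open>b\<close> only, so a solution in it has
  \<open>b\<^sup>2 | x\<close>; giving the multiples of \<open>b\<^sup>2\<close> up to \<open>a b\<^sup>2\<close> to colour 1 forces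
  \<open>x \<ge> (a + 1) b\<^sup>2\<close>, whence \<open>z > a\<^sup>2 b + a b\<close>, the end of colour 0. In colour 2 we have
  \<open>x > a\<^sup>2 b + a b\<close> and \<open>y > a b\<close>, which pushes \<open>z\<close> beyond \<open>M\<close>. The final block of length
  \<open>a b\<close> can be given to colour 1 because the differences \<open>z - y\<close> arising there from small \<open>x\<close>
  are multiples of \<open>a b\<close>, and \<open>a b\<^sup>2 + a\<^sup>2 b \<le> M\<close> separates it from the small elements.
\<close>

definition three_colouring :: "nat \<Rightarrow> nat \<Rightarrow> nat \<Rightarrow> nat" where
  "three_colouring a b i =
     (if i > a^3 + a^2 + a * b + a then 1
      else if \<not> b dvd i then (if i \<le> a * b then 1 else 2)
      else if i > a^2 * b + a * b then 2
      else if b^2 dvd i \<and> i \<le> a * b^2 then 1 else 0)"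

lemma three_colouring_cases:
  "three_colouring a b i = 0 \<or> three_colouring a b i = 1 \<or> three_colouring a b i = 2"
  by (simp add: three_colouring_def)

lemma three_colouring_eq_0D:
  assumes "three_colouring a b i = 0"
  shows "b dvd i" "i \<le> a^2 * b + a * b" "b^2 dvd i \<Longrightarrow> i > a * b^2"
  using assms by (auto simp: three_colouring_def split: if_splits)

lemma three_colouring_eq_1D:
  assumes "three_colouring a b i = 1"
  shows "i > a^3 + a^2 + a * b + a \<or> (\<not> b dvd i \<and> i \<le> a * b) \<or> (b^2 dvd i \<and> i \<le> a * b^2)"
  using assms by (auto simp: three_colouring_def split: if_splits)

lemma three_colouring_eq_2D:
  assumes "three_colouring a b i = 2"
  shows "i \<le> a^3 + a^2 + a * b + a" "\<not> b dvd i \<and> i > a * b \<or> b dvd i \<and> i > a^2 * b + a * b"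
  using assms by (auto simp: three_colouring_def split: if_splits)

lemma no_solution_colour_0:
  fixes a b m y :: nat
  assumes "coprime a b" "b > 0" "y > 0"
    and "three_colouring a b (b * m) = 0" "three_colouring a b y = 0"
    and "three_colouring a b (y + a * m) = 0"
  shows False
proof -
  have "b dvd y" "b dvd y + a * m"
    using assms three_colouring_eq_0D(1) by blast+
  then have "b dvd a * m"
    using dvd_add_right_iff by blast
  with assms(1) have "b dvd m"
    by (simp add: coprime_commute coprime_dvd_mult_right_iff)
  then obtain q where q: "m = b * q" ..
  have "b * m > a * b^2"
    using three_colouring_eq_0D(3)[OF assms(4)] by (simp add: q power2_eq_square)
  then have "q \<ge> a + 1"
    using assms(2) by (simp add: q power2_eq_square mult.commute mult.left_commute)
  \<comment> \<open>Here \<open>a * b * q\<close> is the shift \<open>a * m\<close> from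
    \<open>y\<close> to the third component.\<close>
  then have "a * b * (a + 1) \<le> a * b * q"
    by (rule mult_le_mono2)
  then have "y + a * m > a^2 * b + a * b"
    using assms(3) by (simp add: q power2_eq_square algebra_simps)
  with three_colouring_eq_0D(2)[OF assms(6)] show False
    by simp
qed

lemma no_solution_colour_1:
  fixes a b m y :: nat
  assumes "coprime a b" "b > 0" "a > b" "a^2 + a + b > b^2 + b * a" "y > 0" "m > 0"
    and range: "y + a * m \<le> a^3 + a^2 + a * b + a + a * b"
    and "three_colouring a b (b * m) = 1" "three_colouring a b y = 1"
    and "three_colouring a b (y + a * m) = 1"
  shows False
proof -
  let ?M = "a^3 + a^2 + a * b + a"
  \<comment> \<open>Scaled by \<open>a\<close>, the quadratic hypothesis says that the low elements,
    at most \<open>a * b^2\<close>, cannot reach the top block by a shift of at most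
    \<open>a^2 * b\<close>.\<close>
  have "a * (b^2 + b * a) \<le> a * (a^2 + a + b)"
    using assms(4) by (intro mult_le_mono2) simp
  then have gap: "a * b^2 + a^2 * b \<le> ?M"
    by (simp add: power2_eq_square power3_eq_cube algebra_simps)
  show False
  proof (cases "b * m > ?M")
    \<comment> \<open>Since \<open>a \<ge> b + 1\<close>, the shift \<open>a * m\<close> is at least
      \<open>(b + 1) / b\<close> times \<open>b * m\<close>, so it alone uses up the whole
      range.\<close>
    case True
    have "b^2 \<le> a^2"
      using assms(3) by (intro power_mono) auto
    then have "a * b^2 \<le> a^3"
      by (simp add: power2_eq_square power3_eq_cube)
    moreover have "b * (?M + a * b) = b * ?M + a * b^2" "(b + 1) * ?M = b * ?M + ?M"
      by (simp_all add: power2_eq_square algebra_simps)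
    ultimately have "b * (?M + a * b) \<le> (b + 1) * ?M"
      by linarith
    also have "\<dots> \<le> a * (b * m)"
      using assms(3) True by (intro mult_le_mono) auto
    finally have "b * (?M + a * b) \<le> b * (a * m)"
      by (simp add: mult.left_commute)
    then have "?M + a * b \<le> a * m"
      using assms(2) by simp
    with range assms(5) show False
      by simp
  next
    case False
    then have x: "b^2 dvd b * m" "b * m \<le> a * b^2"
      using three_colouring_eq_1D[OF assms(8)] by auto
    then have "b dvd m"
      using assms(2) by (simp add: power2_eq_square)
    then obtain q where q: "m = b * q" ..
    have q_pos: "q \<ge> 1" and "q \<le> a"
      using assms(2,6) x(2) by (auto simp: q power2_eq_square mult.commute mult.left_commute)
    have diff_ge: "a * b \<le> a * m"
      using mult_le_mono2[OF q_pos, of "a * b"] by (simp add: q mult.assoc)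
    have "a * b * q \<le> a * b * a"
      using \<open>q \<le> a\<close> by (rule mult_le_mono2)
    then have diff_le: "a * m \<le> a^2 * b"
      by (simp add: q power2_eq_square algebra_simps)
    \<comment> \<open>The shift is \<open>a * b * q\<close> with \<open>1 \<le> q \<le> a\<close>.
      From the top block it leaves the range; from a low non-multiple of \<open>b\<close> it gives a
      non-multiple of \<open>b\<close> strictly between \<open>a * b\<close> and the top block; from
      a low multiple of \<open>b^2\<close> it needs \<open>b dvd q\<close>, hence a shift of at
      least \<open>a * b^2\<close>.\<close>
    consider "y > ?M" | "\<not> b dvd y" "y \<le> a * b" | "b^2 dvd y" "y \<le> a * b^2"
      using three_colouring_eq_1D[OF assms(9)] by blast
    then show False
    proof cases
      case 1
      with diff_ge range show False
        by linarith
    next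
      case 2
      have "\<not> b dvd y + a * m"
        using 2(1) by (simp add: q dvd_add_left_iff)
      moreover have "b^2 dvd y + a * m \<Longrightarrow> b dvd y + a * m"
        by (metis dvd_mult_left power2_eq_square)
      ultimately have "y + a * m > ?M \<or> y + a * m \<le> a * b"
        using three_colouring_eq_1D[OF assms(10)] by blast
      moreover have "a * b \<le> a * b^2"
        by (simp add: power2_eq_square)
      ultimately show False
        using 2(2) diff_ge diff_le gap assms(5) by linarith
    next
      case 3
      have "b dvd y"
        using 3(1) by (metis dvd_mult_left power2_eq_square)
      then have "b dvd y + a * m"
        by (simp add: q)
      then have z: "b^2 dvd y + a * m" "y + a * m \<le> a * b^2"
        using three_colouring_eq_1D[OF assms(10)] 3(2) diff_le gap by auto
      have "b^2 dvd b * (a * q)"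
        using z(1) 3(1) by (simp add: q dvd_add_right_iff mult.left_commute)
      then have "b dvd a * q"
        using assms(2) by (simp add: power2_eq_square)
      with assms(1) have "b dvd q"
        by (simp add: coprime_commute coprime_dvd_mult_right_iff)
      with q_pos have "b \<le> q"
        by (auto dest: dvd_imp_le)
      then have "a * b * b \<le> a * b * q"
        by (rule mult_le_mono2)
      with z(2) assms(5) show False
        by (simp add: q power2_eq_square algebra_simps)
    qed
  qed
qed

lemma no_solution_colour_2:
  fixes a b m y :: nat
  assumes "three_colouring a b (b * m) = 2" "three_colouring a b y = 2"
    and "three_colouring a b (y + a * m) = 2"
  shows False
proof -
  have "b * m > b * (a^2 + a)"
    using three_colouring_eq_2D(2)[OF assms(1)] by (simp add: algebra_simps)
  \<comment> \<open>Strictness gains a unit in \<open>m\<close>, which supplies the summand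
    \<open>a\<close> of the bound.\<close>
  then have "a^2 + a + 1 \<le> m"
    by simp
  then have "a * (a^2 + a + 1) \<le> a * m"
    by (rule mult_le_mono2)
  moreover have "y > a * b"
    using three_colouring_eq_2D(2)[OF assms(2)] by auto
  ultimately have "y + a * m > a^3 + a^2 + a * b + a"
    by (simp add: power2_eq_square power3_eq_cube algebra_simps)
  with three_colouring_eq_2D(1)[OF assms(3)] show False
    by simp
qed

lemma no_mono_solution_three_colouring:
  fixes a b n :: nat
  assumes "coprime a b" "b > 0" "a > b" "a^2 + a + b > b^2 + b * a"
    and "n \<le> a^3 + a^2 + (2 * b + 1) * a"
  shows "\<not> has_mono_solution (\<lambda>x y z. a * x + b * y = b * z) (three_colouring a b) n"
proof
  let ?c = "three_colouring a b"
  assume "has_mono_solution (\<lambda>x y z. a * x + b * y = b * z) ?c n"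
  then obtain x y z where xyz: "x > 0" "y > 0" "z \<le> n" "a * x + b * y = b * z"
      "?c x = ?c y" "?c y = ?c z"
    unfolding has_mono_solution_def by (metis atLeastAtMost_iff less_le_trans zero_less_one)
  have "b dvd a * x"
    using xyz(4) by (metis dvd_add_left_iff dvd_triv_left)
  with assms(1) have "b dvd x"
    by (simp add: coprime_commute coprime_dvd_mult_right_iff)
  then obtain m where x: "x = b * m" ..
  have "b * z = b * (y + a * m)"
    using xyz(4) by (simp add: x algebra_simps)
  then have z: "z = y + a * m"
    using assms(2) by simp
  \<comment> \<open>The bound on \<open>n\<close> is regrouped as the start of the top block plus
    its length \<open>a * b\<close>.\<close>
  have le: "y + a * m \<le> a^3 + a^2 + a * b + a + a * b"
    using xyz(3) assms(5) by (simp add: z algebra_simps)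
  have "m > 0"
    using xyz(1) by (simp add: x)
  have c: "?c (b * m) = ?c z" "?c y = ?c z" "?c (y + a * m) = ?c z"
    using xyz(5,6) x z by simp_all
  consider "?c z = 0" | "?c z = 1" | "?c z = 2"
    using three_colouring_cases by metis
  then show False
  proof cases
    case 1
    with no_solution_colour_0[OF assms(1,2) xyz(2)] c show False by simp
  next
    case 2
    with no_solution_colour_1[OF assms(1-4) xyz(2) \<open>m > 0\<close> le] c show False by simp
  next
    case 3
    with no_solution_colour_2 c show False by metis
  qed
qed

text \<open>The least \<open>n\<close> with the property is not below \<open>N\<close>; if there is
  none, the value is infinite, so finiteness need not be settled.\<close>

lemma rado_number_geI:
  assumes "\<And>n. 0 < n \<Longrightarrow> n < N \<Longrightarrow> \<not> rado_property k E n"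
  shows "rado_number k E \<ge> enat N"
proof (cases "\<exists>n>0. rado_property k E n")
  case True
  then have "0 < (LEAST n. n > 0 \<and> rado_property k E n) \<and>
      rado_property k E (LEAST n. n > 0 \<and> rado_property k E n)"
    by (rule LeastI_ex)
  with assms have "N \<le> (LEAST n. n > 0 \<and> rado_property k E n)"
    by (meson not_le)
  with True show ?thesis
    unfolding rado_number_def by (simp only: if_True enat_ord_simps)
next
  case False
  then show ?thesis
    unfolding rado_number_def by (simp only: if_False enat_ord_simps)
qed

theorem theorem3:
  fixes a b :: nat
  assumes "coprime a b" and "a > b" and "b \<ge> 3"
    and "a^2 + a + b > b^2 + b * a"
  shows "rado_number 3 (\<lambda>x y z. a * x + b * y = b * z) \<ge> enat (a^3 + a^2 + (2 * b + 1) * a + 1)"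
proof (rule rado_number_geI)
  fix n
  assume "n < a^3 + a^2 + (2 * b + 1) * a + 1"
  then have "\<not> has_mono_solution (\<lambda>x y z. a * x + b * y = b * z) (three_colouring a b) n"
    using assms by (intro no_mono_solution_three_colouring) auto
  moreover have "three_colouring a b \<in> {1..n} \<rightarrow> {..<3}"
    by (auto simp: three_colouring_def)
  ultimately show "\<not> rado_property 3 (\<lambda>x y z. a * x + b * y = b * z) n"
    unfolding rado_property_def by blast
qed

end
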